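(* Let $G\in\mathbb{C}^{\nu}$ and let $\Sigma_G$ be the $\nu$-order model $\dot\xi=(S-GL)\xi+Gu,\ \psi=C\Pi\xi$, which matches the moments of the system $(A,B,C)$ at $\sigma(S)$. Let $C_{\mathbf P}\in\mathbb{C}^{1\times n}$ be such that $C_{\mathbf P}\Pi=0$, and let $\Upsilon_{\mathbf P}\in\mathbb{C}^{\ell\times n}$ be the unique solution of the Sylvester equation $$Q_{\mathbf P}\Upsilon_{\mathbf P}=\Upsilon_{\mathbf P}A+R_{\mathbf P}C_{\mathbf P}.$$ Assume that $\operatorname{rank}(\Upsilon_{\mathbf P}\Pi)=\ell$. If $G$ is a solution of the equation $$\Upsilon_{\mathbf P}\Pi G=\Upsilon_{\mathbf P}B,$$ then $\sigma(Q_{\mathbf P})=\{\lambda_1,\dots,\lambda_\ell\}\subseteq\sigma(S-GL)$.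
   Context: $\sigma(M)$ denotes the spectrum of a matrix $M$. The single-input single-output system $\dot x=Ax+Bu,\ y=Cx$ has $A\in\mathbb{R}^{n\times n}$, $B\in\mathbb{R}^{n\times 1}$, $C\in\mathbb{R}^{1\times n}$, is controllable and observable, and is stable (all eigenvalues of $A$ have negative real part). Its transfer function is $K(s)=C(sI-A)^{-1}B$. $S\in\mathbb{C}^{\nu\times\nu}$ has symmetric spectrum (closed under complex conjugation) with $\sigma(S)\cap\sigma(A)=\emptyset$, and $L\in\mathbb{C}^{1\times\nu}$ is such that $(L,S)$ is observable. $\Pi\in\mathbb{C}^{n\times\nu}$ is the unique solution of the Sylvester equation $A\Pi+BL=\Pi S$. It has rank $\nu$. The moment of order $j$ of a transfer function $K$ at a point $s^*$ that is not a pole is $\frac{(-1)^j}{j!}K^{(j)}(s^* )$. A model matches the moments of the system at $\sigma(S)$ if, for each $s_i\in\sigma(S)$ of multiplicity $j_i+1$, its moments of orders $0,\dots,j_i$ at $s_i$ coincide with those of $K$. The models $\Sigma_G$, with transfer function $K_G(s)=C\Pi(sI-S+GL)^{-1}G$, have this property for all $G$ with $\sigma(S-GL)\cap\sigma(S)=\emptyset$, and this condition on $G$ is part of the standing assumptions. Let $\ell\le\nu$ and let $\{\lambda_1,\dots,\lambda_\ell\}\subset\mathbb{C}\setminus\sigma(S)$ be a set closed under complex conjugation. $Q_{\mathbf P}\in\mathbb{C}^{\ell\times\ell}$ is a matrix with $\sigma(Q_{\mathbf P})=\{\lambda_1,\dots,\lambda_\ell\}$, and $R_{\mathbf P}\in\mathbb{R}^{\ell}$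 is any vector such that $(Q_{\mathbf P},R_{\mathbf P})$ is controllable. Uniqueness of the solution $\Upsilon_{\mathbf P}$ means that $\sigma(Q_{\mathbf P})\cap\sigma(A)=\emptyset$. *)

theory Defs
  imports
    "HOL-Analysis.Derivative"
    "Jordan_Normal_Form.Spectral_Radius"
    "Jordan_Normal_Form.Gauss_Jordan_Elimination"
    "Jordan_Normal_Form.DL_Rank"
begin

abbreviation cmat :: "real mat \<Rightarrow> complex mat" where
  "cmat \<equiv> map_mat complex_of_real"

abbreviation mat_rank :: "'a::field mat \<Rightarrow> nat" where
  "mat_rank M \<equiv> vec_space.rank (dim_row M) M"

text \<open>Kalman rank conditions for a single input (\<open>B\<close> is an \<open>n \<times> 1\<close> matrix) and a single
  output (\<open>C\<close> is a \<open>1 \<times> n\<close> matrix).\<close>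

definition controllable :: "'a::field mat \<Rightarrow> 'a mat \<Rightarrow> bool" where
  "controllable A B \<longleftrightarrow>
     mat_rank (mat_of_cols (dim_row A) (map (\<lambda>i. col (A ^\<^sub>m i * B) 0) [0..<dim_row A])) = dim_row A"

definition observable :: "'a::field mat \<Rightarrow> 'a mat \<Rightarrow> bool" where
  "observable C A \<longleftrightarrow>
     mat_rank (mat_of_rows (dim_row A) (map (\<lambda>i. row (C * A ^\<^sub>m i) 0) [0..<dim_row A])) = dim_row A"

definition stable_mat :: "complex mat \<Rightarrow> bool" where
  "stable_mat A \<longleftrightarrow> (\<forall>z\<in>spectrum A. Re z < 0)"

text \<open>The value at \<open>s \<in> spectrum A\<close> is unspecified, since \<open>mat_inverse\<close> then returns \<open>None\<close>.\<close>

definition transfer_function :: "complex mat \<Rightarrow> complex mat \<Rightarrow> complex mat \<Rightarrow> complex \<Rightarrow> complex" where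
  "transfer_function A B C s =
     (C * the (mat_inverse (s \<cdot>\<^sub>m 1\<^sub>m (dim_row A) - A)) * B) $$ (0, 0)"

definition moment :: "(complex \<Rightarrow> complex) \<Rightarrow> nat \<Rightarrow> complex \<Rightarrow> complex" where
  "moment K j s = (- 1) ^ j / fact j * (deriv ^^ j) K s"

text \<open>Multiplicity of an eigenvalue is algebraic multiplicity; multiplicity \<open>j + 1\<close> means that
  the orders \<open>0, \<dots>, j\<close> are matched. Meaningful when neither transfer function has a pole
  in \<open>spectrum S\<close>.\<close>

definition matches_moments :: "complex mat \<Rightarrow> (complex \<Rightarrow> complex) \<Rightarrow> (complex \<Rightarrow> complex) \<Rightarrow> bool" where
  "matches_moments S K K' \<longleftrightarrow>
     (\<forall>s\<in>spectrum S. \<forall>j<Polynomial.order s (char_poly S). moment K' j s = moment K j s)"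

end

theory Submission
  imports Defs
begin

text \<open>Put \<open>Y = \<Upsilon>\<^sub>P \<Pi>\<^sub>S\<close>. Multiplying the Sylvester equation of \<open>\<Upsilon>\<^sub>P\<close> by \<open>\<Pi>\<^sub>S\<close> from the right, that of
  \<open>\<Pi>\<^sub>S\<close> by \<open>\<Upsilon>\<^sub>P\<close> from the left, and using \<open>C\<^sub>P \<Pi>\<^sub>S = 0\<close> and \<open>\<Upsilon>\<^sub>P B = Y G\<close>, one gets
  \<open>Q\<^sub>P Y = Y (S - G L)\<close>. Since \<open>Y\<close> has full row rank, it maps left eigenvectors of \<open>Q\<^sub>P\<close> to left
  eigenvectors of \<open>S - G L\<close>.\<close>

text \<open>A maximal independent set of columns has \<open>rank M = n\<close> elements, so by
  counting dimensions it is already a basis of the whole space.\<close>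

lemma (in vec_space) full_row_rank_col_space:
  assumes M: "M \<in> carrier_mat n nc" and r: "rank M = n"
  shows "col_space M = carrier_vec n"
proof -
  let ?P = "\<lambda>T. T \<subseteq> set (cols M) \<and> lin_indpt T"
  have cM: "set (cols M) \<subseteq> carrier_vec n" using M cols_dim by blast
  \<comment> \<open>The empty set is the seed that is enlarged to a maximal independent set of
    columns; finiteness of the column set bounds the growth.\<close>
  have "lin_indpt {}" by (simp add: lin_dep_def)
  then obtain T where T: "finite T" "maximal T ?P"
    using maximal_exists_superset[of "set (cols M)" ?P "{}"] by auto
  then have sub: "T \<subseteq> set (cols M)" and li: "lin_indpt T" by (auto simp: maximal_def)
  have "card T = n" using rank_card_indpt[OF M T(2)] r by simp
  then have "basis T"
    using dim_li_is_basis[OF fin_dim T(1) _ li] sub cM dim_is_n by auto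
  then have "span T = carrier_vec n" by (simp add: basis_def)
  then show ?thesis
    using span_is_monotone[OF sub] span_is_subset2[OF cM] unfolding col_space_def by auto
qed

text \<open>Full row rank makes \<open>M\<close> surjective, and a vector killed by
  \<open>M\<^sup>T\<close> is orthogonal to the range of \<open>M\<close>, hence to every unit
  vector.\<close>

lemma full_row_rank_transpose_inj:
  fixes M :: "'a::field mat"
  assumes M: "M \<in> carrier_mat nr nc" and r: "mat_rank M = nr"
    and v: "v \<in> carrier_vec nr" and z: "M\<^sup>T *\<^sub>v v = 0\<^sub>v nc"
  shows "v = 0\<^sub>v nr"
proof (rule eq_vecI)
  interpret vec_space "TYPE('a)" nr .
  fix i assume "i < dim_vec (0\<^sub>v nr :: 'a vec)"
  then have i: "i < nr" by simp
  have "unit_vec nr i \<in> col_space M"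
    using full_row_rank_col_space[OF M] r M by simp
  then obtain x where x: "x \<in> carrier_vec nc" "M *\<^sub>v x = unit_vec nr i"
    using col_space_eq[OF M] M by auto
  \<comment> \<open>The coordinate is the scalar product with a unit vector, here written as
    \<open>M *\<^sub>v x\<close> so that \<open>M\<close> can be moved to the other factor as
    \<open>M\<^sup>T\<close>.\<close>
  have "v $ i = (M *\<^sub>v x) \<bullet> v" using x(2) v i by simp
  also have "\<dots> = x \<bullet> (M\<^sup>T *\<^sub>v v)"
    using transpose_vec_mult_scalar[OF M x(1) v] M v x
    by (metis comm_scalar_prod mult_mat_vec_carrier transpose_carrier_mat)
  also have "\<dots> = 0" using z x(1) by simp
  finally show "v $ i = 0\<^sub>v nr $ i" using i by simp
qed (use v in simp)

text \<open>Eigenvalues are the roots of the characteristic polynomial, which transposition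
  preserves.\<close>

lemma spectrum_transpose:
  fixes M :: "'a::field mat"
  assumes "M \<in> carrier_mat n n"
  shows "spectrum M\<^sup>T = spectrum M"
  using assms eigenvalue_root_char_poly[of M n] eigenvalue_root_char_poly[of "M\<^sup>T" n]
  by (auto simp: spectrum_def)

text \<open>Left eigenvectors are handled as right eigenvectors of the transposes:
  \<open>Y\<^sup>T\<close> sends an eigenvector of \<open>Q\<^sup>T\<close> for \<open>z\<close> to
  one of \<open>F\<^sup>T\<close> for the same \<open>z\<close>.\<close>

lemma spectrum_subset_of_intertwining:
  fixes Q F Y :: "'a::field mat"
  assumes Q: "Q \<in> carrier_mat k k" and F: "F \<in> carrier_mat m m" and Y: "Y \<in> carrier_mat k m"
    and r: "mat_rank Y = k" and eq: "Q * Y = Y * F"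
  shows "spectrum Q \<subseteq> spectrum F"
proof
  fix z assume "z \<in> spectrum Q"
  then have "z \<in> spectrum Q\<^sup>T" using spectrum_transpose[OF Q] by simp
  then obtain v where v: "v \<in> carrier_vec k" "v \<noteq> 0\<^sub>v k" "Q\<^sup>T *\<^sub>v v = z \<cdot>\<^sub>v v"
    using Q by (auto simp: spectrum_def eigenvalue_def eigenvector_def)
  let ?w = "Y\<^sup>T *\<^sub>v v"
  have Ts: "Q\<^sup>T \<in> carrier_mat k k" "F\<^sup>T \<in> carrier_mat m m" "Y\<^sup>T \<in> carrier_mat m k"
    using Q F Y by auto
  have w: "?w \<in> carrier_vec m" using Ts v by auto
  \<comment> \<open>This is where the rank enters: without injectivity of \<open>Y\<^sup>T\<close>
    the image could vanish and would be no eigenvector.\<close>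
  have "?w \<noteq> 0\<^sub>v m" using full_row_rank_transpose_inj[OF Y r v(1)] v(2) by blast
  moreover have "F\<^sup>T *\<^sub>v ?w = z \<cdot>\<^sub>v ?w"
  proof -
    have "F\<^sup>T * Y\<^sup>T = Y\<^sup>T * Q\<^sup>T"
      using transpose_mult[OF Q Y] transpose_mult[OF Y F] eq by simp
    then have "F\<^sup>T *\<^sub>v ?w = Y\<^sup>T *\<^sub>v (Q\<^sup>T *\<^sub>v v)"
      using assoc_mult_mat_vec[OF Ts(2,3) v(1)] assoc_mult_mat_vec[OF Ts(3,1) v(1)] by simp
    then show ?thesis using v mult_mat_vec[OF Ts(3) v(1)] by simp
  qed
  ultimately have "z \<in> spectrum F\<^sup>T"
    using w F by (auto simp: spectrum_def eigenvalue_def eigenvector_def)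
  then show "z \<in> spectrum F" using spectrum_transpose[OF F] by simp
qed

text \<open>Both sides equal \<open>U * (A * P)\<close>. On the left, \<open>Cp * P = 0\<close>
  removes the \<open>R\<close> term. On the right, \<open>UPG\<close> turns
  \<open>U * P * (G * L)\<close> into \<open>U * (B * L)\<close>, and the equation for
  \<open>P\<close> leaves \<open>U * (A * P)\<close>.\<close>

lemma sylvester_intertwining:
  fixes A B S L P G Cp Q U R :: "'a::comm_ring_1 mat"
  assumes A: "A \<in> carrier_mat n n" and B: "B \<in> carrier_mat n p"
    and S: "S \<in> carrier_mat m m" and L: "L \<in> carrier_mat p m"
    and P: "P \<in> carrier_mat n m" and G: "G \<in> carrier_mat m p"
    and Q: "Q \<in> carrier_mat k k" and R: "R \<in> carrier_mat k q"
    and Cp: "Cp \<in> carrier_mat q n" and U: "U \<in> carrier_mat k n"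
    and sylP: "A * P + B * L = P * S"
    and sylU: "Q * U = U * A + R * Cp"
    and CpP: "Cp * P = 0\<^sub>m q m"
    and UPG: "U * P * G = U * B"
  shows "Q * (U * P) = U * P * (S - G * L)"
proof -
  have "Q * (U * P) = (U * A + R * Cp) * P"
    using assoc_mult_mat[OF Q U P] sylU by simp
  also have "\<dots> = U * A * P + R * Cp * P"
    using U A R Cp P by (intro add_mult_distrib_mat) auto
  also have "R * Cp * P = 0\<^sub>m k m"
    using assoc_mult_mat[OF R Cp P] CpP R by simp
  finally have 1: "Q * (U * P) = U * (A * P)"
    using U A P by simp
  have "U * (A * P) + U * (B * L) = U * (P * S)"
    using U A P B L sylP
    by (metis mult_add_distrib_mat mult_carrier_mat)
  moreover have "U * (B * L) = U * P * (G * L)"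
    using UPG assoc_mult_mat[OF U B L] assoc_mult_mat[of "U * P" k m G p L m] U P G L by simp
  ultimately have 2: "U * (A * P) + U * P * (G * L) = U * P * S"
    using assoc_mult_mat[OF U P S] by simp
  have "U * P * (S - G * L) = U * P * S - U * P * (G * L)"
    using U P S G L by (intro mult_minus_distrib_mat) auto
  \<comment> \<open>Rewriting \<open>U * P * S\<close> backwards as a sum lets the
    \<open>G * L\<close> term cancel, entry by entry.\<close>
  also have "\<dots> = U * (A * P)"
    unfolding 2[symmetric] using U A P G L by (intro eq_matI) auto
  finally show ?thesis using 1 by simp
qed

theorem theorem6:
  fixes n \<nu> l :: nat
    and A B C :: "real mat"
    and S L \<Pi>\<^sub>S G :: "complex mat"
    and C\<^sub>P Q\<^sub>P \<Upsilon>\<^sub>P :: "complex mat"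
    and R\<^sub>P :: "real mat"
    and lam :: "nat \<Rightarrow> complex"
  assumes "A \<in> carrier_mat n n" and "B \<in> carrier_mat n 1" and "C \<in> carrier_mat 1 n"
    and "controllable A B" and "observable C A" and "stable_mat (cmat A)"
    and "S \<in> carrier_mat \<nu> \<nu>" and "cnj ` spectrum S = spectrum S"
    and "spectrum S \<inter> spectrum (cmat A) = {}"
    and "L \<in> carrier_mat 1 \<nu>" and "observable L S"
    and "\<Pi>\<^sub>S \<in> carrier_mat n \<nu>"
    and "cmat A * \<Pi>\<^sub>S + cmat B * L = \<Pi>\<^sub>S * S"
    and "mat_rank \<Pi>\<^sub>S = \<nu>"
    and "G \<in> carrier_mat \<nu> 1"
    and "spectrum (S - G * L) \<inter> spectrum S = {}"
    and "matches_moments S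
           (transfer_function (cmat A) (cmat B) (cmat C))
           (transfer_function (S - G * L) G (cmat C * \<Pi>\<^sub>S))"
    and "l \<le> \<nu>"
    and "lam ` {1..l} \<inter> spectrum S = {}" and "cnj ` lam ` {1..l} = lam ` {1..l}"
    and "Q\<^sub>P \<in> carrier_mat l l" and "spectrum Q\<^sub>P = lam ` {1..l}"
    and "R\<^sub>P \<in> carrier_mat l 1" and "controllable Q\<^sub>P (cmat R\<^sub>P)"
    and "C\<^sub>P \<in> carrier_mat 1 n" and "C\<^sub>P * \<Pi>\<^sub>S = 0\<^sub>m 1 \<nu>"
    and "spectrum Q\<^sub>P \<inter> spectrum (cmat A) = {}"
    and "\<Upsilon>\<^sub>P \<in> carrier_mat l n"
    and "Q\<^sub>P * \<Upsilon>\<^sub>P = \<Upsilon>\<^sub>P * cmat A + cmat R\<^sub>P * C\<^sub>P"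
    and "mat_rank (\<Upsilon>\<^sub>P * \<Pi>\<^sub>S) = l"
    and "\<Upsilon>\<^sub>P * \<Pi>\<^sub>S * G = \<Upsilon>\<^sub>P * cmat B"
  shows "spectrum Q\<^sub>P = lam ` {1..l} \<and> lam ` {1..l} \<subseteq> spectrum (S - G * L)"
proof -
  have "Q\<^sub>P * (\<Upsilon>\<^sub>P * \<Pi>\<^sub>S) = \<Upsilon>\<^sub>P * \<Pi>\<^sub>S * (S - G * L)"
    by (rule sylvester_intertwining[of "cmat A" n "cmat B" 1 S \<nu> L \<Pi>\<^sub>S G Q\<^sub>P l "cmat R\<^sub>P" 1 C\<^sub>P])
      (use assms in auto)
  \<comment> \<open>Full row rank of \<open>\<Upsilon>\<^sub>P * \<Pi>\<^sub>S\<close> turns the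
    intertwining relation into an inclusion of spectra.\<close>
  then have "spectrum Q\<^sub>P \<subseteq> spectrum (S - G * L)"
    using assms(7,10,12,15,21,28,30)
    by (intro spectrum_subset_of_intertwining[of Q\<^sub>P l "S - G * L" \<nu> "\<Upsilon>\<^sub>P * \<Pi>\<^sub>S"]) auto
  then show ?thesis using assms(22) by simp
qed

end
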